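(* (Midpoint inequality) Let $I\subset\mathbb{R}$ be an interval with interior $I^{\circ}$, let $a,b\in I^{\circ}$ with $a<b$, and let $f:I\to\mathbb{R}$ be twice differentiable on $I^{\circ}$ with $f,f',f''\in L[a,b]$. Let $p,q\ge 1$ be real with $\frac1p+\frac1q=1$, and suppose $|f''|^q$ is convex on $[a,b]$. Then $$\left|f\left(\tfrac{a+b}{2}\right)-\frac1{b-a}\int_a^b f(x)\,dx\right|\le (b-a)^2\left(\frac{1}{2^{2p+1}(p+1)}\right)^{\frac1p}\left\{\left[\frac{|f''(b)|^q}{2^{q+2}(q+2)}+\beta\left(\tfrac12;q+1,2\right)|f''(a)|^q\right]^{\frac1q}+\left[\beta\left(\tfrac12;q+1,2\right)|f''(b)|^q+\frac{|f''(a)|^q}{2^{q+2}(q+2)}\right]^{\frac1q}\right\}.$$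
   Context: $L[a,b]$ denotes the Lebesgue integrable real-valued functions on $[a,b]$. $\beta$ is the (unnormalized) incomplete Beta function $\beta(x;u,v)=\int_0^x t^{u-1}(1-t)^{v-1}\,dt$ for $x\in[0,1]$, $u,v>0$. *)

theory Defs
  imports "HOL-Analysis.Analysis"
begin

(* Unnormalized; intended for x in [0,1] and u, v > 0.  Since 0 powr r = 0 for every r,
   the integrand vanishes at the endpoints 0 and 1 also when u \<le> 1 or v \<le> 1;
   being null sets, these points do not affect the integral. *)
definition incomplete_Beta :: "real \<Rightarrow> real \<Rightarrow> real \<Rightarrow> real" where
  "incomplete_Beta x u v =
     (LINT t:{0..x}|lebesgue. t powr (u - 1) * (1 - t) powr (v - 1))"

end

theory Submission
  imports Defs
begin

text \<open>
  With \<open>c = b - a\<close>, two integrations by parts from each endpoint towards the midpoint give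
  \<open>1/c \<integral>\<^sub>a\<^sup>b f - f((a+b)/2) = c\<^sup>2/2 \<integral>\<^sub>0\<^sup>1\<^sup>/\<^sup>2 t\<^sup>2 (f''(a+ct) + f''(b-ct)) dt\<close>.
  Splitting \<open>t\<^sup>2 |f''| = t \<cdot> (t |f''|)\<close> in Hoelder's inequality and bounding \<open>|f''|\<^sup>q\<close> by
  convexity turns each half into one of the two summands of the estimate.
\<close>

text \<open>Since only a majorant \<open>w\<close> of \<open>v powr q\<close> is integrated, no measurability of \<open>v\<close> is needed.\<close>

lemma Holder_inequality_majorant:
  fixes p q P R :: real and h u v w :: "'a::euclidean_space \<Rightarrow> real"
  assumes pq: "p > 1" "q > 1" "1 / p + 1 / q = 1"
    and h: "h integrable_on S"
    and P: "((\<lambda>x. u x powr p) has_integral P) S"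
    and R: "(w has_integral R) S"
    and u: "\<And>x. x \<in> S \<Longrightarrow> 0 \<le> u x"
    and v: "\<And>x. x \<in> S \<Longrightarrow> 0 \<le> v x"
    and w: "\<And>x. x \<in> S \<Longrightarrow> v x powr q \<le> w x"
    and le: "\<And>x. x \<in> S \<Longrightarrow> \<bar>h x\<bar> \<le> u x * v x"
    and "P > 0"
  shows "\<bar>integral S h\<bar> \<le> P powr (1 / p) * R powr (1 / q)"
proof -
  have "R \<ge> 0"
  proof (rule has_integral_nonneg[OF R])
    fix x assume "x \<in> S"
    then show "0 \<le> w x" using w[of x] powr_ge_zero[of "v x" q] by linarith
  qed
  \<comment> \<open>\<open>R\<close> may be zero, so \<open>v\<close> cannot be normalized by
    \<open>R powr (1 / q)\<close>. Any \<open>T > R\<close> gives a positive normalizer, and letting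
    \<open>T\<close> tend to \<open>R\<close> recovers the claim.\<close>
  have above: "\<bar>integral S h\<bar> \<le> P powr (1 / p) * T powr (1 / q)" if "T > R" for T
  proof -
    have "T > 0" using that \<open>R \<ge> 0\<close> by simp
    define \<alpha> where "\<alpha> = P powr (1 / p)"
    define \<beta> where "\<beta> = T powr (1 / q)"
    have pos: "\<alpha> > 0" "\<beta> > 0" using \<open>P > 0\<close> \<open>T > 0\<close> by (auto simp: \<alpha>_def \<beta>_def)
    have \<alpha>p: "\<alpha> powr p = P" and \<beta>q: "\<beta> powr q = T"
      using pq \<open>P > 0\<close> \<open>T > 0\<close> by (auto simp: \<alpha>_def \<beta>_def powr_powr)
    \<comment> \<open>Young's bound for \<open>(u x / \<alpha>) * (v x / \<beta>)\<close>,
      multiplied back by \<open>\<alpha> * \<beta>\<close>, with \<open>w x\<close> in place of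
      \<open>v x powr q\<close>.\<close>
    define g where "g = (\<lambda>x. \<alpha> * \<beta> * (u x powr p * (1 / (P * p)) + w x * (1 / (T * q))))"
    have g: "(g has_integral \<alpha> * \<beta> * (P * (1 / (P * p)) + R * (1 / (T * q)))) S"
      unfolding g_def by (intro has_integral_mult_right has_integral_add has_integral_mult_left P R)
    have "norm (integral S h) \<le> integral S g"
    proof (rule integral_norm_bound_integral[OF h has_integral_integrable[OF g]])
      fix x assume x: "x \<in> S"
      have "u x / \<alpha> * (v x / \<beta>) \<le> (u x / \<alpha>) powr p / p + (v x / \<beta>) powr q / q"
        using u[OF x] v[OF x] pos by (intro Youngs_inequality pq) auto
      also have "\<dots> = u x powr p * (1 / (P * p)) + v x powr q * (1 / (T * q))"
        using u[OF x] v[OF x] pos by (simp add: powr_divide \<alpha>p \<beta>q)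
      also have "\<dots> \<le> u x powr p * (1 / (P * p)) + w x * (1 / (T * q))"
        using w[OF x] \<open>T > 0\<close> pq by (intro add_left_mono mult_right_mono) auto
      finally have "u x * v x \<le> g x"
        using pos by (simp add: g_def field_simps)
      then show "norm (h x) \<le> g x" using le[OF x] by simp
    qed
    also have "\<dots> = \<alpha> * \<beta> * (P * (1 / (P * p)) + R * (1 / (T * q)))"
      using g by (rule integral_unique)
    \<comment> \<open>The first summand is exactly \<open>1 / p\<close>; the second is at most
      \<open>1 / q\<close> because \<open>R / T < 1\<close>.\<close>
    also have "\<dots> \<le> \<alpha> * \<beta> * (1 / p + 1 / q)"
      using pos \<open>P > 0\<close> \<open>T > 0\<close> that pq
      by (intro mult_left_mono add_mono) (auto simp: field_simps)
    finally show ?thesis using pq(3) by (simp add: \<alpha>_def \<beta>_def)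
  qed
  have "((\<lambda>T. P powr (1 / p) * T powr (1 / q)) \<longlongrightarrow> P powr (1 / p) * R powr (1 / q)) (at_right R)"
  proof (intro tendsto_mult tendsto_const tendsto_powr')
    show "((\<lambda>T. T) \<longlongrightarrow> R) (at_right R)" by (rule tendsto_ident_at)
    \<comment> \<open>At \<open>R = 0\<close> the power is still right-continuous, since its
      exponent \<open>1 / q\<close> is positive and \<open>T\<close> approaches through nonnegative
      values.\<close>
    show "R \<noteq> 0 \<or> 0 < 1 / q \<and> (\<forall>\<^sub>F T in at_right R. 0 \<le> T)"
      using pq \<open>R \<ge> 0\<close> by (auto simp: eventually_at_right_less intro!: eventually_mono[OF eventually_at_right_less])
  qed
  then show ?thesis
    by (rule tendsto_lowerbound)
      (auto intro!: eventually_mono[OF eventually_at_right_less] above)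
qed

text \<open>With \<open>u > 1\<close> and \<open>x < 1\<close> the integrand is continuous on the
  closed interval for every \<open>v\<close>, so the Lebesgue integral in the definition is also a
  gauge integral, the notion used in the estimates.\<close>

lemma incomplete_Beta_has_integral:
  fixes x u v :: real
  assumes "0 \<le> x" "x < 1" "u > 1"
  shows "((\<lambda>t. t powr (u - 1) * (1 - t) powr (v - 1)) has_integral incomplete_Beta x u v) {0..x}"
proof -
  have "continuous_on {0..x} (\<lambda>t. t powr (u - 1) * (1 - t) powr (v - 1))"
    using assms by (intro continuous_intros continuous_on_powr') auto
  then have "(\<lambda>t. t powr (u - 1) * (1 - t) powr (v - 1)) absolutely_integrable_on {0..x}"
    by (rule absolutely_integrable_continuous_real)
  then show ?thesis
    unfolding incomplete_Beta_def by (rule has_integral_set_lebesgue)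
qed

text \<open>Hoelder with factors \<open>t\<close> and \<open>t * \<bar>g t\<bar>\<close>: the first
  contributes the integral of \<open>t powr p\<close>. In the second, the weight
  \<open>t powr q\<close> against the affine majorant gives the coefficient of \<open>B\<close> from
  its part \<open>t\<close> and the incomplete Beta value from its part
  \<open>1 - t\<close>.\<close>

lemma quadratic_moment_bound:
  fixes g :: "real \<Rightarrow> real" and A B p q :: real
  assumes pq: "p > 1" "q > 1" "1 / p + 1 / q = 1"
    and int: "(\<lambda>t. t\<^sup>2 * g t) integrable_on {0..1/2}"
    and g: "\<And>t. t \<in> {0..1/2} \<Longrightarrow> \<bar>g t\<bar> powr q \<le> (1 - t) * A + t * B"
  shows "\<bar>integral {0..1/2} (\<lambda>t. t\<^sup>2 * g t)\<bar> / 2 \<le>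
    (1 / (2 powr (2 * p + 1) * (p + 1))) powr (1 / p) *
    (B / (2 powr (q + 2) * (q + 2)) + incomplete_Beta (1 / 2) (q + 1) 2 * A) powr (1 / q)"
proof -
  define P where "P = 1 / (2 powr (p + 1) * (p + 1))"
  have half: "(1 / 2) powr r = 1 / 2 powr r" for r :: real
    by (simp add: powr_divide)
  have P: "((\<lambda>t. t powr p) has_integral P) {0..1/2}"
    using has_integral_powr_from_0[of p "1/2"] pq by (simp add: P_def half)
  have "((\<lambda>t. t powr (q + 1)) has_integral 1 / (2 powr (q + 2) * (q + 2))) {0..1/2}"
    using has_integral_powr_from_0[of "q + 1" "1/2"] pq by (simp add: half add.assoc)
  then have "((\<lambda>t. t powr (q + 1) * B + t powr (q + 1 - 1) * (1 - t) powr (2 - 1) * A) has_integral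
      1 / (2 powr (q + 2) * (q + 2)) * B + incomplete_Beta (1 / 2) (q + 1) 2 * A) {0..1/2}"
    using pq by (intro has_integral_add has_integral_mult_left incomplete_Beta_has_integral) auto
  then have R: "((\<lambda>t. t powr q * ((1 - t) * A + t * B)) has_integral
      B / (2 powr (q + 2) * (q + 2)) + incomplete_Beta (1 / 2) (q + 1) 2 * A) {0..1/2}"
    by (rule has_integral_eq_rhs[OF has_integral_eq, rotated])
      (auto simp: powr_add algebra_simps)
  have "\<bar>integral {0..1/2} (\<lambda>t. t\<^sup>2 * g t)\<bar> \<le> P powr (1 / p) *
    (B / (2 powr (q + 2) * (q + 2)) + incomplete_Beta (1 / 2) (q + 1) 2 * A) powr (1 / q)"
  proof (rule Holder_inequality_majorant[OF pq int P R, where v = "\<lambda>t. t * \<bar>g t\<bar>"])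
    fix t :: real assume t: "t \<in> {0..1/2}"
    show "(t * \<bar>g t\<bar>) powr q \<le> t powr q * ((1 - t) * A + t * B)"
      using t g[OF t] by (simp add: powr_mult mult_left_mono)
  qed (use pq in \<open>auto simp: P_def power2_eq_square abs_mult\<close>)
  \<comment> \<open>The outer factor 1/2 enters the root as \<open>(1 / 2) powr p\<close>, which
    raises the exponent of 2 from \<open>p + 1\<close> to \<open>2 * p + 1\<close>.\<close>
  moreover have "P powr (1 / p) / 2 = (1 / (2 powr (2 * p + 1) * (p + 1))) powr (1 / p)"
  proof -
    have "(1 / (2 powr (2 * p + 1) * (p + 1))) = P * (1 / 2) powr p"
      by (simp add: P_def half powr_add[symmetric])
    then show ?thesis
      using pq by (simp only: powr_mult powr_powr) simp
  qed
  ultimately show ?thesis by (simp add: divide_simps)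
qed

text \<open>The estimate for the half running from the endpoint \<open>e\<close> to the midpoint.
  The order of \<open>e\<close> and \<open>d\<close> is left open, so that one statement serves both
  halves; for \<open>d < e\<close> the step \<open>d - e\<close> is negative.\<close>

lemma half_midpoint_inequality:
  fixes F f f' f'' :: "real \<Rightarrow> real" and d e p q :: real
  assumes pq: "p > 1" "q > 1" "1 / p + 1 / q = 1" and "d \<noteq> e"
    and F: "\<And>x. x \<in> closed_segment e d \<Longrightarrow> (F has_real_derivative f x) (at x)"
    and f: "\<And>x. x \<in> closed_segment e d \<Longrightarrow> (f has_real_derivative f' x) (at x)"
    and f': "\<And>x. x \<in> closed_segment e d \<Longrightarrow> (f' has_real_derivative f'' x) (at x)"
    and conv: "convex_on (closed_segment e d) (\<lambda>x. \<bar>f'' x\<bar> powr q)"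
  defines "m \<equiv> (e + d) / 2"
  shows "\<bar>(d - e) * f' m / 8 - f m / 2 + (F m - F e) / (d - e)\<bar> \<le>
    (d - e)\<^sup>2 * (1 / (2 powr (2 * p + 1) * (p + 1))) powr (1 / p) *
    (\<bar>f'' d\<bar> powr q / (2 powr (q + 2) * (q + 2))
      + incomplete_Beta (1 / 2) (q + 1) 2 * \<bar>f'' e\<bar> powr q) powr (1 / q)"
proof -
  define c where "c = d - e"
  define y where "y = (\<lambda>t. e + c * t)"
  \<comment> \<open>The antiderivative that two integrations by parts produce: on differentiation
    the terms in \<open>f'\<close> cancel, as do those in \<open>f\<close>, and only the term in
    \<open>f''\<close> survives.\<close>
  define \<Phi> where "\<Phi> = (\<lambda>t. t\<^sup>2 / 2 * c * f' (y t) - t * f (y t) + F (y t) / c)"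
  have c: "c \<noteq> 0" using \<open>d \<noteq> e\<close> by (simp add: c_def)
  have y_eq: "y t = (1 - t) *\<^sub>R e + t *\<^sub>R d" for t
    by (simp add: y_def c_def algebra_simps)
  have y_in: "y t \<in> closed_segment e d" if "t \<in> {0..1/2}" for t
    using that unfolding y_eq in_segment by (intro exI[of _ t]) auto
  have y_deriv: "(y has_real_derivative c) (at t)" for t
    unfolding y_def by (auto intro!: derivative_eq_intros)
  have deriv: "(\<Phi> has_real_derivative c\<^sup>2 / 2 * (t\<^sup>2 * f'' (y t))) (at t)" if "t \<in> {0..1/2}" for t
  proof -
    note [derivative_intros] =
      DERIV_chain2[OF F[OF y_in[OF that]] y_deriv]
      DERIV_chain2[OF f[OF y_in[OF that]] y_deriv]
      DERIV_chain2[OF f'[OF y_in[OF that]] y_deriv]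
    show ?thesis
      unfolding \<Phi>_def using c
      by (auto intro!: derivative_eq_intros simp: field_simps power2_eq_square)
  qed
  have ftc: "((\<lambda>t. c\<^sup>2 / 2 * (t\<^sup>2 * f'' (y t))) has_integral \<Phi> (1/2) - \<Phi> 0) {0..1/2}"
    using deriv by (intro fundamental_theorem_of_calculus)
      (auto simp flip: has_real_derivative_iff_has_vector_derivative
            intro: has_field_derivative_at_within)
  \<comment> \<open>Integrability is read off from the fundamental theorem, as \<open>f''\<close> is
    not assumed continuous.\<close>
  have int: "(\<lambda>t. t\<^sup>2 * f'' (y t)) integrable_on {0..1/2}"
    using has_integral_integrable[OF ftc] c by simp
  have "m = y (1/2)"
    by (simp add: m_def y_def c_def field_simps)
  then have "c * f' m / 8 - f m / 2 + (F m - F e) / c = \<Phi> (1/2) - \<Phi> 0"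
    using c by (simp add: \<Phi>_def y_def power2_eq_square diff_divide_distrib)
  also have "\<dots> = c\<^sup>2 / 2 * integral {0..1/2} (\<lambda>t. t\<^sup>2 * f'' (y t))"
    using integral_unique[OF ftc] by simp
  finally have eq: "\<bar>c * f' m / 8 - f m / 2 + (F m - F e) / c\<bar> =
      c\<^sup>2 * (\<bar>integral {0..1/2} (\<lambda>t. t\<^sup>2 * f'' (y t))\<bar> / 2)"
    by (simp only: abs_mult) simp
  have "\<bar>integral {0..1/2} (\<lambda>t. t\<^sup>2 * f'' (y t))\<bar> / 2 \<le>
    (1 / (2 powr (2 * p + 1) * (p + 1))) powr (1 / p) *
    (\<bar>f'' d\<bar> powr q / (2 powr (q + 2) * (q + 2))
      + incomplete_Beta (1 / 2) (q + 1) 2 * \<bar>f'' e\<bar> powr q) powr (1 / q)"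
  proof (rule quadratic_moment_bound[OF pq int])
    fix t :: real assume "t \<in> {0..1/2}"
    then show "\<bar>f'' (y t)\<bar> powr q \<le> (1 - t) * \<bar>f'' e\<bar> powr q + t * \<bar>f'' d\<bar> powr q"
      unfolding y_eq by (intro convex_onD[OF conv]) auto
  qed
  from mult_left_mono[OF this, of "c\<^sup>2"] show ?thesis
    unfolding eq[symmetric] by (simp add: c_def mult.assoc)
qed

theorem proposition1:
  fixes I :: "real set" and a b p q :: real and f f' f'' :: "real \<Rightarrow> real"
  assumes "is_interval I"
    and "a \<in> interior I" and "b \<in> interior I" and "a < b"
    and "\<And>x. x \<in> interior I \<Longrightarrow> (f has_real_derivative f' x) (at x)"
    and "\<And>x. x \<in> interior I \<Longrightarrow> (f' has_real_derivative f'' x) (at x)"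
    and "f absolutely_integrable_on {a..b}"
    and "f' absolutely_integrable_on {a..b}"
    and "f'' absolutely_integrable_on {a..b}"
    and "p \<ge> 1" and "q \<ge> 1" and "1 / p + 1 / q = 1"
    and "convex_on {a..b} (\<lambda>x. \<bar>f'' x\<bar> powr q)"
  shows "\<bar>f ((a + b) / 2) - 1 / (b - a) * (LINT x:{a..b}|lebesgue. f x)\<bar>
    \<le> (b - a)\<^sup>2 * (1 / (2 powr (2 * p + 1) * (p + 1))) powr (1 / p) *
      ((\<bar>f'' b\<bar> powr q / (2 powr (q + 2) * (q + 2))
          + incomplete_Beta (1 / 2) (q + 1) 2 * \<bar>f'' a\<bar> powr q) powr (1 / q)
       + (incomplete_Beta (1 / 2) (q + 1) 2 * \<bar>f'' b\<bar> powr q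
          + \<bar>f'' a\<bar> powr q / (2 powr (q + 2) * (q + 2))) powr (1 / q))"
proof -
  have I: "open (interior I)" "is_interval (interior I)"
    using assms(1) by (simp_all add: is_interval_convex_1)
  have sub: "{a..b} \<subseteq> interior I"
    using mem_is_interval_1_I[OF I(2) assms(2,3)] by auto
  \<comment> \<open>Two-sided derivatives are required at \<open>a\<close> and \<open>b\<close> as
    well, so \<open>f\<close> is integrated from a point left of \<open>a\<close>, on an interval
    that extends beyond both endpoints but stays inside \<open>interior I\<close>.\<close>
  obtain F where F: "\<And>x. x \<in> {a..b} \<Longrightarrow> (F has_real_derivative f x) (at x)"
  proof -
    obtain r s where r: "r > 0" "cball a r \<subseteq> interior I" and s: "s > 0" "cball b s \<subseteq> interior I"
      using I(1) assms(2,3) by (meson open_contains_cball)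
    have ends: "a - r \<in> interior I" "b + s \<in> interior I"
      using subsetD[OF r(2), of "a - r"] subsetD[OF s(2), of "b + s"] r(1) s(1)
      by (simp_all add: dist_real_def)
    have "{a - r..b + s} \<subseteq> interior I"
      using mem_is_interval_1_I[OF I(2) ends] by auto
    then have "continuous_on {a - r..b + s} f"
      by (intro continuous_at_imp_continuous_on ballI) (blast intro: DERIV_isCont assms(5))
    then have D: "((\<lambda>x. integral {a - r..x} f) has_real_derivative f x) (at x within {a - r..b + s})"
      if "x \<in> {a..b}" for x
      using that r s by (intro integral_has_real_derivative) auto
    show thesis
    proof (rule that)
      fix x assume x: "x \<in> {a..b}"
      then have "at x within {a - r..b + s} = at x"
        using r s by (intro at_within_Icc_at) auto
      then show "((\<lambda>x. integral {a - r..x} f) has_real_derivative f x) (at x)"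
        using D[OF x] by simp
    qed
  qed
  have "(f has_integral F b - F a) {a..b}"
    using F less_imp_le[OF \<open>a < b\<close>] by (intro fundamental_theorem_of_calculus)
      (auto simp flip: has_real_derivative_iff_has_vector_derivative
            intro: has_field_derivative_at_within)
  then have LINT: "(LINT x:{a..b}|lebesgue. f x) = F b - F a"
    using set_lebesgue_integral_eq_integral(2)[OF assms(7)] by (simp add: integral_unique)
  \<comment> \<open>If one exponent were 1, the reciprocal of the other would be 0. In HOL this
    means that the other exponent is 0, contrary to its being at least 1.\<close>
  have "p \<noteq> 1" "q \<noteq> 1"
    using assms(10-12) by auto
  then have pq: "p > 1" "q > 1"
    using assms(10,11) by simp_all
  have seg: "closed_segment a b = {a..b}" "closed_segment b a = {a..b}"
    using \<open>a < b\<close> by (auto simp: closed_segment_eq_real_ivl)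
  define m where "m = (a + b) / 2"
  define K where "K = (1 / (2 powr (2 * p + 1) * (p + 1))) powr (1 / p)"
  define A where "A = (\<bar>f'' b\<bar> powr q / (2 powr (q + 2) * (q + 2))
          + incomplete_Beta (1 / 2) (q + 1) 2 * \<bar>f'' a\<bar> powr q) powr (1 / q)"
  define B where "B = (incomplete_Beta (1 / 2) (q + 1) 2 * \<bar>f'' b\<bar> powr q
          + \<bar>f'' a\<bar> powr q / (2 powr (q + 2) * (q + 2))) powr (1 / q)"
  have 1: "\<bar>(b - a) * f' m / 8 - f m / 2 + (F m - F a) / (b - a)\<bar> \<le> (b - a)\<^sup>2 * K * A"
    unfolding m_def K_def A_def
    using \<open>a < b\<close> sub F assms(5,6,13) by (intro half_midpoint_inequality pq assms(12)) (auto simp: seg)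
  have m_eq: "m = (b + a) / 2" and B_eq: "B = (\<bar>f'' a\<bar> powr q / (2 powr (q + 2) * (q + 2))
          + incomplete_Beta (1 / 2) (q + 1) 2 * \<bar>f'' b\<bar> powr q) powr (1 / q)"
    by (simp_all add: m_def B_def add.commute)
  \<comment> \<open>The same lemma with \<open>e = b\<close> and \<open>d = a\<close>, hence with
    the negative step \<open>a - b\<close>.\<close>
  have 2: "\<bar>(a - b) * f' m / 8 - f m / 2 + (F m - F b) / (a - b)\<bar> \<le> (a - b)\<^sup>2 * K * B"
    unfolding m_eq K_def B_eq
    using \<open>a < b\<close> sub F assms(5,6,13) by (intro half_midpoint_inequality pq assms(12)) (auto simp: seg)
  have "1 / (b - a) * (F b - F a) = (F m - F a) / (b - a) + (F m - F b) / (a - b)"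
    using \<open>a < b\<close> by (simp add: divide_simps) (simp add: algebra_simps)
  moreover have "(a - b) * f' m = - ((b - a) * f' m)"
    by (simp add: algebra_simps)
  \<comment> \<open>When the two halves are added, the terms in \<open>f' m\<close> and in
    \<open>F m\<close> cancel because the steps \<open>b - a\<close> and \<open>a - b\<close> are
    opposite; the two copies of \<open>f m / 2\<close> make up \<open>f m\<close>.\<close>
  ultimately have "f m - 1 / (b - a) * (F b - F a) =
      - ((b - a) * f' m / 8 - f m / 2 + (F m - F a) / (b - a))
      - ((a - b) * f' m / 8 - f m / 2 + (F m - F b) / (a - b))"
    by linarith
  then have "\<bar>f m - 1 / (b - a) * (F b - F a)\<bar> \<le> (b - a)\<^sup>2 * K * (A + B)"
    using 1 2 unfolding distrib_left power2_commute[of a b] by linarith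
  then show ?thesis
    unfolding LINT m_def K_def A_def B_def .
qed

end
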